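(* Let $X$ be a locally compact Hausdorff space with Borel $\sigma$-algebra $\Omega$, $E$ a Banach lattice, and $P\colon\Omega\to\mathcal L_{\mathrm r}(E)$ a regular positive spectral measure. Then, for all $\Delta\in\Omega$, (1) $P(\Delta)=\inf\{P(V): V\text{ open and }\Delta\subset V\}$ in $\mathcal L_{\mathrm r}(E)$; (2) $P(\Delta)=\sup\{P(K): K\text{ compact and }K\subset\Delta\}$ in $\mathcal L_{\mathrm r}(E)$.
   Context: All vector spaces are real. $E$ is not assumed Dedekind complete; the existence of the infimum and supremum in the ordered vector space $\mathcal L_{\mathrm r}(E)$ is part of the assertion. $\mathcal L_{\mathrm r}(E)$ denotes the regular operators on $E$ (differences of two positive linear operators) with the usual operator ordering. A positive spectral measure on $\Omega$ is a map $P\colon\Omega\to\mathcal L_{\mathrm r}(E)$ such that: each $P(\Delta)$ is a positive projection; $P(\emptyset)=0$; $P(\Delta_1\cap\Delta_2)=P(\Delta_1)P(\Delta_2)$ for all $\Delta_1,\Delta_2\in\Omega$; and for pairwise disjoint $\Delta_n\in\Omega$ ($n\geq1$) and $x\in E$ one has $P(\bigcup_n\Delta_n)x=\sum_nP(\Delta_n)x$ with norm convergence. ($P(X)$ need not be the identity.) For $x\in E$ and $x'$ in the norm dual $E'$, put $\mu_{x,x'}(\Delta)=\langle P(\Delta)x,x'\rangle$ ($\Delta\in\Omega$), a finite signed measure. $P$ is regular if every $\mu_{x,x'}$ is a regular finite signed Borel measure, i.e. a difference of two finite positive measures on $\Omega$ that are outer regular (by open sets) on all Borel sets and inner regular (by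 compact sets) on all open sets. *)

theory Defs
  imports "HOL-Analysis.Analysis" "HOL-Library.Lattice_Algebras" "HOL-Algebra.Order"
begin

section \<open>Banach lattices and regular operators\<close>

text \<open>The modulus of \<open>lattice_ab_group_add_abs\<close> is \<open>\<bar>x\<bar> = sup x (- x)\<close>.\<close>

class banach_lattice = banach + ordered_real_vector + lattice_ab_group_add_abs +
  assumes norm_mono_abs: "\<bar>x\<bar> \<le> \<bar>y\<bar> \<Longrightarrow> norm x \<le> norm y"

instance real :: banach_lattice
  by standard simp

definition positive_operator :: "('e::banach_lattice \<Rightarrow> 'e) \<Rightarrow> bool" where
  "positive_operator T \<longleftrightarrow> linear T \<and> (\<forall>x\<ge>0. 0 \<le> T x)"

definition regular_operator :: "('e::banach_lattice \<Rightarrow> 'e) \<Rightarrow> bool" where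
  "regular_operator T \<longleftrightarrow>
     (\<exists>R S. positive_operator R \<and> positive_operator S \<and> T = (\<lambda>x. R x - S x))"

text \<open>
  The ordered set \<open>\<L>\<^sub>r(E)\<close>: infima and suprema of sets of regular operators are taken
  among the regular operators only.
\<close>

definition regular_operators :: "('e::banach_lattice \<Rightarrow> 'e) gorder" where
  "regular_operators =
     \<lparr>carrier = {T. regular_operator T}, eq = (=),
      le = (\<lambda>S T. positive_operator (\<lambda>x. T x - S x))\<rparr>"

definition is_infimum :: "('a, 'b) gorder_scheme \<Rightarrow> 'a set \<Rightarrow> 'a \<Rightarrow> bool" where
  "is_infimum L A g \<longleftrightarrow> A \<subseteq> carrier L \<and> greatest L g (Lower L A)"

definition is_supremum :: "('a, 'b) gorder_scheme \<Rightarrow> 'a set \<Rightarrow> 'a \<Rightarrow> bool" where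
  "is_supremum L A l \<longleftrightarrow> A \<subseteq> carrier L \<and> least L l (Upper L A)"

lemma positive_imp_regular_operator: "positive_operator T \<Longrightarrow> regular_operator T"
  unfolding regular_operator_def positive_operator_def
  by (rule exI[of _ T], rule exI[of _ "\<lambda>_. 0"]) (simp add: linear_zero)

lemma partial_order_regular_operators: "partial_order regular_operators"
proof -
  have *: "S = T" if le: "positive_operator (\<lambda>x. T x - S x)" "positive_operator (\<lambda>x. S x - T x)"
    for S T :: "'e::banach_lattice \<Rightarrow> 'e"
  proof
    fix x :: 'e
    have lin: "linear (\<lambda>x. T x - S x)" and eq: "T y - S y = 0" if "0 \<le> y" for y
      using le that unfolding positive_operator_def by (auto intro: antisym)
    have "x = pprt x - (- nprt x)" by (simp add: prts[symmetric])
    moreover have "T (pprt x - (- nprt x)) - S (pprt x - (- nprt x)) =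
        (T (pprt x) - S (pprt x)) - (T (- nprt x) - S (- nprt x))"
      using linear_diff[OF lin[OF order_refl]] .
    ultimately show "S x = T x" using eq[of "pprt x"] eq[of "- nprt x"] by simp
  qed
  have tr: "positive_operator (\<lambda>x. W x - U x)"
    if "positive_operator (\<lambda>x. V x - U x)" "positive_operator (\<lambda>x. W x - V x)"
    for U V W :: "'e::banach_lattice \<Rightarrow> 'e"
  proof -
    have "linear (\<lambda>x. (V x - U x) + (W x - V x))"
      using that unfolding positive_operator_def by (intro linear_compose_add) auto
    moreover have "0 \<le> (V x - U x) + (W x - V x)" if "0 \<le> x" for x
      using that \<open>positive_operator (\<lambda>x. V x - U x)\<close> \<open>positive_operator (\<lambda>x. W x - V x)\<close>
      unfolding positive_operator_def by (intro add_nonneg_nonneg) auto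
    ultimately show ?thesis unfolding positive_operator_def by simp
  qed
  show ?thesis
    by unfold_locales
      (auto simp: regular_operators_def positive_operator_def[of "\<lambda>_. 0"] linear_zero
        intro: * tr)
qed


section \<open>Regular finite Borel measures\<close>

definition borel_of :: "'a topology \<Rightarrow> 'a measure" where
  "borel_of X = sigma (topspace X) {U. openin X U}"

definition finite_regular_measure :: "'a topology \<Rightarrow> 'a measure \<Rightarrow> bool" where
  "finite_regular_measure X M \<longleftrightarrow>
     finite_measure M \<and> sets M = sets (borel_of X) \<and>
     (\<forall>A\<in>sets (borel_of X). emeasure M A = (INF V\<in>{V. openin X V \<and> A \<subseteq> V}. emeasure M V)) \<and>
     (\<forall>U. openin X U \<longrightarrow> emeasure M U = (SUP K\<in>{K. compactin X K \<and> K \<subseteq> U}. emeasure M K))"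

definition regular_signed_measure :: "'a topology \<Rightarrow> ('a set \<Rightarrow> real) \<Rightarrow> bool" where
  "regular_signed_measure X \<mu> \<longleftrightarrow>
     (\<exists>M N. finite_regular_measure X M \<and> finite_regular_measure X N \<and>
       (\<forall>\<Delta>\<in>sets (borel_of X). \<mu> \<Delta> = measure M \<Delta> - measure N \<Delta>))"

section \<open>Positive spectral measures\<close>

text \<open>Only the values of \<open>P\<close> on \<open>sets M\<close> are relevant; \<open>P (space M)\<close> need not be the identity.\<close>

definition positive_spectral_measure ::
    "'a measure \<Rightarrow> ('a set \<Rightarrow> 'e::banach_lattice \<Rightarrow> 'e) \<Rightarrow> bool" where
  "positive_spectral_measure M P \<longleftrightarrow>
     (\<forall>\<Delta>\<in>sets M. positive_operator (P \<Delta>) \<and> P \<Delta> \<circ> P \<Delta> = P \<Delta>) \<and>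
     P {} = (\<lambda>x. 0) \<and>
     (\<forall>\<Delta>\<^sub>1\<in>sets M. \<forall>\<Delta>\<^sub>2\<in>sets M. P (\<Delta>\<^sub>1 \<inter> \<Delta>\<^sub>2) = P \<Delta>\<^sub>1 \<circ> P \<Delta>\<^sub>2) \<and>
     (\<forall>\<Delta> :: nat \<Rightarrow> 'a set. range \<Delta> \<subseteq> sets M \<longrightarrow> disjoint_family \<Delta> \<longrightarrow>
        (\<forall>x. (\<lambda>n. P (\<Delta> n) x) sums P (\<Union>n. \<Delta> n) x))"

definition regular_spectral_measure ::
    "'a topology \<Rightarrow> ('a set \<Rightarrow> 'e::banach_lattice \<Rightarrow> 'e) \<Rightarrow> bool" where
  "regular_spectral_measure X P \<longleftrightarrow>
     (\<forall>(x::'e) (x' :: 'e \<Rightarrow>\<^sub>L real).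
        regular_signed_measure X (\<lambda>\<Delta>. blinfun_apply x' (P \<Delta> x)))"

end

theory Submission
  imports Defs
begin

text \<open>
  The inequality between operators is tested on vectors \<open>x \<ge> 0\<close> and positive functionals \<open>x'\<close>,
  where it becomes outer (respectively inner) regularity of the measure \<open>\<mu>\<^sub>x\<^sub>,\<^sub>x\<^sub>'\<close>. Positive functionals
  detect the positive cone by the Hahn--Banach theorem applied to the sublinear functional
  \<open>z \<mapsto> \<parallel>z\<^sup>+\<parallel>\<close>: a linear functional below it is positive and contractive. Writing a regular signed
  measure as \<open>M - N\<close>, the approximation error from above is at most that of \<open>M\<close> alone, and
  inner regularity of \<open>M\<close> on all Borel sets follows from its finiteness by taking complements.
\<close>

section \<open>The Hahn--Banach theorem\<close>

text \<open>Homogeneity is only required as an inequality, so less has to be checked for a new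
  functional. Equality follows by scaling back with \<open>1 / c\<close>, see
  \<open>sublinear_scaleR\<close>.\<close>

definition sublinear :: "('a::real_vector \<Rightarrow> real) \<Rightarrow> bool" where
  "sublinear q \<longleftrightarrow>
     (\<forall>x y. q (x + y) \<le> q x + q y) \<and> (\<forall>c\<ge>0. \<forall>x. q (c *\<^sub>R x) \<le> c * q x)"

lemma sublinear_add: "sublinear q \<Longrightarrow> q (x + y) \<le> q x + q y"
  and sublinear_scaleR_le: "sublinear q \<Longrightarrow> 0 \<le> c \<Longrightarrow> q (c *\<^sub>R x) \<le> c * q x"
  by (auto simp: sublinear_def)

lemma sublinear_zero:
  assumes "sublinear q" shows "q 0 = 0"
  using sublinear_scaleR_le[OF assms, of 0 0] sublinear_add[OF assms, of 0 0] by simp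

lemma sublinear_scaleR:
  assumes q: "sublinear q" and c: "0 \<le> c"
  shows "q (c *\<^sub>R x) = c * q x"
proof (cases "c = 0")
  case True
  then show ?thesis by (simp add: sublinear_zero[OF q])
next
  case False
  with c have "0 < c" by simp
  have "q x = q ((1 / c) *\<^sub>R c *\<^sub>R x)" using False by simp
  also have "\<dots> \<le> (1 / c) * q (c *\<^sub>R x)" by (rule sublinear_scaleR_le[OF q]) (use c in simp)
  finally have "c * q x \<le> q (c *\<^sub>R x)" using \<open>0 < c\<close> by (simp add: field_simps)
  with sublinear_scaleR_le[OF q c] show ?thesis by (rule antisym)
qed

lemma sublinear_minus_le:
  assumes "sublinear q" shows "- q (- x) \<le> q x"
  using sublinear_add[OF assms, of x "- x"] sublinear_zero[OF assms] by simp

text \<open>Serves both for an infimum along a ray of parameters and for the infimum of a chain. The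
  index \<open>k\<close> may depend on the vectors. Boundedness and \<open>I \<noteq> {}\<close>
  give the real infimum its meaning.\<close>

lemma sublinear_INF:
  fixes f :: "'i \<Rightarrow> 'a::real_vector \<Rightarrow> real"
  assumes "I \<noteq> {}"
    and bdd: "\<And>x. bdd_below ((\<lambda>i. f i x) ` I)"
    and add: "\<And>i j x y. i \<in> I \<Longrightarrow> j \<in> I \<Longrightarrow> \<exists>k\<in>I. f k (x + y) \<le> f i x + f j y"
    and scale: "\<And>i c x. i \<in> I \<Longrightarrow> 0 \<le> c \<Longrightarrow> \<exists>k\<in>I. f k (c *\<^sub>R x) \<le> c * f i x"
  shows "sublinear (\<lambda>x. INF i\<in>I. f i x)"
proof -
  let ?u = "\<lambda>x. INF i\<in>I. f i x"
  have u: "?u x \<le> f i x" if "i \<in> I" for i x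
    using bdd that by (rule cINF_lower)
  have "?u (x + y) \<le> ?u x + ?u y" for x y
  proof -
    have *: "?u (x + y) \<le> f i x + f j y" if "i \<in> I" "j \<in> I" for i j
      using add[OF that, of x y] u order_trans by blast
    \<comment> \<open>The infima are taken one index at a time: over \<open>j\<close> with
      \<open>i\<close> fixed, then over \<open>i\<close>.\<close>
    have "?u (x + y) - f i x \<le> ?u y" if "i \<in> I" for i
      using \<open>I \<noteq> {}\<close> by (rule cINF_greatest) (use *[OF that] in \<open>simp add: algebra_simps\<close>)
    then have "?u (x + y) - ?u y \<le> f i x" if "i \<in> I" for i
      using that by (simp add: algebra_simps)
    with \<open>I \<noteq> {}\<close> have "?u (x + y) - ?u y \<le> ?u x" by (rule cINF_greatest)
    then show ?thesis by simp
  qed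
  moreover have "?u (c *\<^sub>R x) \<le> c * ?u x" if "0 \<le> c" for c x
  proof -
    have *: "?u (c *\<^sub>R x) \<le> c * f i x" if "i \<in> I" for i
      using scale[OF that \<open>0 \<le> c\<close>, of x] u order_trans by blast
    show ?thesis
    \<comment> \<open>For \<open>c = 0\<close> one cannot divide by \<open>c\<close>, but
      \<open>*\<close> at any index already has right-hand side 0.\<close>
    proof (cases "c = 0")
      case True
      then show ?thesis using * \<open>I \<noteq> {}\<close> by auto
    next
      case False
      with that have "0 < c" by simp
      have "?u (c *\<^sub>R x) / c \<le> ?u x"
        using \<open>I \<noteq> {}\<close>
        by (rule cINF_greatest) (use * \<open>0 < c\<close> in \<open>simp add: field_simps\<close>)
      then show ?thesis using \<open>0 < c\<close> by (simp add: field_simps)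
    qed
  qed
  ultimately show ?thesis by (simp add: sublinear_def)
qed

text \<open>The witness is the infimum of \<open>p (x + t *\<^sub>R a) - t * p a\<close> over
  \<open>t \<ge> 0\<close>; the values \<open>t = 0\<close> and \<open>t = 1\<close> give the two
  bounds. At \<open>x = - a\<close> the second bound reads
  \<open>q (- a) \<le> - p a\<close>.\<close>

lemma sublinear_lower_at:
  assumes p: "sublinear p"
  obtains q where "sublinear q" "q \<le> p" "\<And>x. q x \<le> p (x + a) - p a"
proof
  let ?f = "\<lambda>t x. p (x + t *\<^sub>R a) - t * p a"
  let ?q = "\<lambda>x. INF t\<in>{0..}. ?f t x"
  have bdd: "bdd_below ((\<lambda>t. ?f t x) ` {0..})" for x
  proof (rule bdd_belowI2[where m = "- p (- x)"])
    fix t :: real assume "t \<in> {0..}"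
    then have "t * p a = p ((x + t *\<^sub>R a) + - x)" by (simp add: sublinear_scaleR[OF p])
    also have "\<dots> \<le> p (x + t *\<^sub>R a) + p (- x)" by (rule sublinear_add[OF p])
    finally show "- p (- x) \<le> ?f t x" by simp
  qed
  show "sublinear ?q"
  proof (rule sublinear_INF[OF _ bdd])
    fix s t :: real and x y assume st: "s \<in> {0..}" "t \<in> {0..}"
    have "?f (s + t) (x + y) \<le> ?f s x + ?f t y"
      using sublinear_add[OF p, of "x + s *\<^sub>R a" "y + t *\<^sub>R a"] by (simp add: algebra_simps)
    then show "\<exists>k\<in>{0..}. ?f k (x + y) \<le> ?f s x + ?f t y"
      using st by (intro bexI[of _ "s + t"]) auto
  next
    fix t c :: real and x assume tc: "t \<in> {0..}" "0 \<le> c"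
    have "?f (c * t) (c *\<^sub>R x) \<le> c * ?f t x"
      using sublinear_scaleR_le[OF p \<open>0 \<le> c\<close>, of "x + t *\<^sub>R a"] by (simp add: algebra_simps)
    then show "\<exists>k\<in>{0..}. ?f k (c *\<^sub>R x) \<le> c * ?f t x"
      using tc by (intro bexI[of _ "c * t"]) auto
  qed auto
  have "?q x \<le> ?f t x" if "0 \<le> t" for t x
    using bdd by (rule cINF_lower) (use that in simp)
  from this[of 0] this[of 1] show "?q \<le> p" and "?q x \<le> p (x + a) - p a" for x
    by (simp_all add: le_fun_def)
qed

text \<open>Lowering \<open>q\<close> at \<open>y\<close> cannot change it, so the bound from
  \<open>sublinear_lower_at\<close> holds for \<open>q\<close> itself and is the missing
  superadditivity.\<close>

lemma linear_if_minimal_sublinear: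
  assumes q: "sublinear q" and minimal: "\<And>r. sublinear r \<Longrightarrow> r \<le> q \<Longrightarrow> r = q"
  shows "linear q"
proof -
  have add: "q (x + y) = q x + q y" for x y
  proof -
    obtain r where "sublinear r" "r \<le> q" "\<And>x. r x \<le> q (x + y) - q y"
      using sublinear_lower_at[OF q] by metis
    with minimal have "q x \<le> q (x + y) - q y" by metis
    with sublinear_add[OF q, of x y] show ?thesis by simp
  qed
  have minus: "q (- x) = - q x" for x
    using add[of x "- x"] sublinear_zero[OF q] by simp
  have "q (c *\<^sub>R x) = c *\<^sub>R q x" for c x
  proof (cases "0 \<le> c")
    case True
    then show ?thesis by (simp add: sublinear_scaleR[OF q])
  next
    case False
    then have "q ((- c) *\<^sub>R x) = - c * q x" by (intro sublinear_scaleR[OF q]) simp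
    then show ?thesis using minus[of "c *\<^sub>R x"] by simp
  qed
  with add show ?thesis by (rule linearI)
qed

text \<open>Zorn's lemma for the reversed pointwise order. A chain is bounded by its pointwise
  infimum, which is finite because every sublinear \<open>r \<le> p\<close> satisfies
  \<open>- p (- x) \<le> r x\<close>.\<close>

lemma minimal_sublinear_exists:
  assumes p: "sublinear p"
  obtains q where "sublinear q" "q \<le> p" "\<And>r. sublinear r \<Longrightarrow> r \<le> q \<Longrightarrow> r = q"
proof -
  define A where "A = {q. sublinear q \<and> q \<le> p}"
  have "\<exists>m\<in>A. \<forall>a\<in>A. m \<ge> a \<longrightarrow> a = m"
  proof (rule predicate_Zorn)
    show "partial_order_on A (relation_of (\<ge>) A)"
      by (rule partial_order_on_relation_ofI) auto
  next
    fix C assume "C \<in> Chains (relation_of (\<ge>) A)"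
    then have C: "\<forall>q\<in>C. \<forall>r\<in>C. q \<in> A \<and> r \<in> A \<and> (q \<ge> r \<or> r \<ge> q)"
      by (auto simp: Chains_def relation_of_def)
    have CA: "q \<in> A" if "q \<in> C" for q
      using C that by blast
    have chain: "q \<le> r \<or> r \<le> q" if "q \<in> C" "r \<in> C" for q r
      using C that by blast
    show "\<exists>u\<in>A. \<forall>q\<in>C. q \<ge> u"
    \<comment> \<open>The empty chain is bounded by \<open>p\<close>; a real infimum over the empty
      set would be of no use.\<close>
    proof (cases "C = {}")
      case True
      then show ?thesis using p by (auto simp: A_def)
    next
      case False
      let ?u = "\<lambda>x. INF q\<in>C. q x"
      have bdd: "bdd_below ((\<lambda>q. q x) ` C)" for x
      proof (rule bdd_belowI2[where m = "- p (- x)"])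
        fix q assume "q \<in> C"
        then have "sublinear q" "q (- x) \<le> p (- x)" using CA by (auto simp: A_def le_fun_def)
        then show "- p (- x) \<le> q x" using sublinear_minus_le[of q x] by simp
      qed
      have "sublinear ?u"
      proof (rule sublinear_INF[OF False bdd])
        fix q r x y assume qr: "q \<in> C" "r \<in> C"
        have *: "q (x + y) \<le> q x + q y" "r (x + y) \<le> r x + r y"
          using CA[OF qr(1)] CA[OF qr(2)] by (auto simp: A_def sublinear_add)
        \<comment> \<open>The smaller of \<open>q\<close> and \<open>r\<close> can replace the
          other; this is where comparability in the chain enters.\<close>
        from chain[OF qr] show "\<exists>k\<in>C. k (x + y) \<le> q x + r y"
        proof
          assume "q \<le> r"
          then show ?thesis using * qr by (intro bexI[of _ q]) (auto simp: le_fun_def intro: order_trans)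
        next
          assume "r \<le> q"
          then show ?thesis using * qr by (intro bexI[of _ r]) (auto simp: le_fun_def intro: order_trans)
        qed
      next
        fix q and c :: real and x assume "q \<in> C" "0 \<le> c"
        then show "\<exists>k\<in>C. k (c *\<^sub>R x) \<le> c * q x"
          using CA by (auto simp: A_def intro!: bexI[of _ q] sublinear_scaleR_le)
      qed
      moreover have below: "?u \<le> q" if "q \<in> C" for q
        using cINF_lower[OF bdd that] by (auto simp: le_fun_def)
      moreover have "?u \<le> p"
      proof -
        obtain q where "q \<in> C" using False by blast
        then show ?thesis using below CA order_trans by (fastforce simp: A_def)
      qed
      ultimately show ?thesis by (auto simp: A_def)
    qed
  qed
  then obtain q where "sublinear q" "q \<le> p" "\<And>r. sublinear r \<Longrightarrow> r \<le> p \<Longrightarrow> r \<le> q \<Longrightarrow> r = q"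
    by (auto simp: A_def)
  then show thesis using that order_trans by blast
qed

text \<open>A minimal sublinear functional below \<open>p\<close> is linear but may miss the value
  \<open>p a\<close>. Starting instead from \<open>p\<close> lowered at \<open>a\<close> forces
  \<open>f (- a) \<le> - p a\<close>, hence equality at \<open>a\<close>.\<close>

theorem Hahn_Banach_sublinear:
  assumes p: "sublinear p"
  obtains f where "linear f" "\<And>x. f x \<le> p x" "f a = p a"
proof -
  obtain q where q: "sublinear q" "q \<le> p" "\<And>x. q x \<le> p (x + a) - p a"
    using sublinear_lower_at[OF p] by metis
  obtain f where f: "sublinear f" "f \<le> q" "\<And>r. sublinear r \<Longrightarrow> r \<le> f \<Longrightarrow> r = f"
    using minimal_sublinear_exists[OF q(1)] by metis
  have lin: "linear f" by (rule linear_if_minimal_sublinear[OF f(1,3)])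
  have le: "f x \<le> p x" for x using f(2) q(2) by (meson le_funD order_trans)
  have "- f a = f (- a)" by (simp add: linear_neg[OF lin])
  also have "\<dots> \<le> q (- a)" using f(2) by (simp add: le_fun_def)
  also have "\<dots> \<le> - p a" using q(3)[of "- a"] sublinear_zero[OF p] by simp
  finally have "f a = p a" using le[of a] by simp
  with lin le show thesis by (rule that)
qed


section \<open>Positive functionals on a Banach lattice\<close>

lemma norm_mono_nonneg:
  fixes x y :: "'e::banach_lattice"
  assumes "0 \<le> x" "x \<le> y" shows "norm x \<le> norm y"
  using assms by (intro norm_mono_abs) simp

text \<open>\<open>pprt x + pprt y\<close> dominates both \<open>x + y\<close> and 0, hence the
  positive part of the sum; the lattice norm is monotone on the positive cone.\<close>

lemma sublinear_norm_pprt: "sublinear (\<lambda>x::'e::banach_lattice. norm (pprt x))"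
  unfolding sublinear_def
proof (intro conjI allI impI)
  fix x y :: 'e
  have "pprt (x + y) \<le> pprt x + pprt y"
    unfolding pprt_def by (intro sup_least add_mono add_nonneg_nonneg) auto
  then have "norm (pprt (x + y)) \<le> norm (pprt x + pprt y)"
    by (intro norm_mono_nonneg) auto
  also have "\<dots> \<le> norm (pprt x) + norm (pprt y)" by (rule norm_triangle_ineq)
  finally show "norm (pprt (x + y)) \<le> norm (pprt x) + norm (pprt y)" .
next
  fix c :: real and x :: 'e assume c: "0 \<le> c"
  have "pprt (c *\<^sub>R x) \<le> c *\<^sub>R pprt x"
    unfolding pprt_def using c by (intro sup_least scaleR_left_mono scaleR_nonneg_nonneg) auto
  then have "norm (pprt (c *\<^sub>R x)) \<le> norm (c *\<^sub>R pprt x)"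
    by (intro norm_mono_nonneg) auto
  then show "norm (pprt (c *\<^sub>R x)) \<le> c * norm (pprt x)" using c by simp
qed

text \<open>Choose \<open>f\<close> below the norm of the positive part with equality at
  \<open>- y\<close>. Such an \<open>f\<close> is positive, so \<open>f (- y) \<le> 0\<close> by
  hypothesis, and the negative part of \<open>y\<close> has norm 0.\<close>

lemma nonneg_if_positive_functionals_nonneg:
  fixes y :: "'e::banach_lattice"
  assumes nonneg: "\<And>f :: 'e \<Rightarrow>\<^sub>L real. (\<And>x. 0 \<le> x \<Longrightarrow> 0 \<le> blinfun_apply f x) \<Longrightarrow> 0 \<le> blinfun_apply f y"
  shows "0 \<le> y"
proof -
  obtain f where f: "linear f" "\<And>x::'e. f x \<le> norm (pprt x)" "f (- y) = norm (pprt (- y))"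
    using Hahn_Banach_sublinear[OF sublinear_norm_pprt] by metis
  have pprt_le: "norm (pprt x) \<le> norm x" for x :: 'e
  proof -
    have "pprt x \<le> \<bar>x\<bar>" unfolding pprt_def by (intro sup_least abs_ge_self abs_ge_zero)
    then have "norm (pprt x) \<le> norm \<bar>x\<bar>" by (intro norm_mono_nonneg) auto
    also have "\<dots> \<le> norm x" by (rule norm_mono_abs) simp
    finally show ?thesis .
  qed
  have bounded: "bounded_linear f"
  proof (rule bounded_linear_intro[where K = 1])
    fix x
    have "f x \<le> norm x" "- f x \<le> norm x"
      using f(2)[of x] f(2)[of "- x"] pprt_le[of x] pprt_le[of "- x"] linear_neg[OF f(1), of x]
      by simp_all
    then show "norm (f x) \<le> norm x * 1" by simp
  qed (use f(1) in \<open>simp_all add: linear_add linear_scale\<close>)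
  \<comment> \<open>For \<open>x \<ge> 0\<close> the positive part of \<open>- x\<close> is 0, so
    \<open>f (- x) \<le> 0\<close>.\<close>
  have "0 \<le> f x" if "0 \<le> x" for x
    using f(2)[of "- x"] that by (simp add: linear_neg[OF f(1)])
  with nonneg[of "Blinfun f"] have "0 \<le> f y" by (simp add: bounded_linear_Blinfun_apply[OF bounded])
  with f(3) have "norm (pprt (- y)) \<le> 0" using linear_neg[OF f(1), of y] by linarith
  then have "pprt (- y) = 0" by simp
  then show ?thesis by (metis le_iff_sup neg_le_0_iff_le pprt_def sup.commute)
qed


section \<open>Regularity of finite measures\<close>

lemma sets_borel_of: "sets (borel_of X) = sigma_sets (topspace X) {U. openin X U}"
  and space_borel_of: "space (borel_of X) = topspace X"
  unfolding borel_of_def using openin_subset by (auto intro!: sets_measure_of space_measure_of)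

lemma openin_borel_of: "openin X U \<Longrightarrow> U \<in> sets (borel_of X)"
  by (auto simp: sets_borel_of)

lemma compactin_borel_of:
  assumes "Hausdorff_space X" "compactin X K" shows "K \<in> sets (borel_of X)"
proof -
  have "closedin X K" using assms by (rule compactin_imp_closedin)
  then have "K = topspace X - (topspace X - K)" "openin X (topspace X - K)"
    using closedin_subset by fastforce+
  then show ?thesis by (metis openin_borel_of sets.compl_sets space_borel_of)
qed

lemma finite_regular_measure_outer:
  assumes M: "finite_regular_measure X M" and A: "A \<in> sets (borel_of X)" and e: "0 < e"
  obtains V where "openin X V" "A \<subseteq> V" "measure M (V - A) < e"
proof -
  interpret finite_measure M using M by (simp add: finite_regular_measure_def)
  have sets: "sets M = sets (borel_of X)" using M by (simp add: finite_regular_measure_def)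
  have "(INF V\<in>{V. openin X V \<and> A \<subseteq> V}. emeasure M V) = emeasure M A"
    using M A by (simp add: finite_regular_measure_def)
  also have "\<dots> < ennreal (measure M A + e)"
    using e by (simp add: emeasure_eq_measure ennreal_less_iff)
  finally obtain V where V: "openin X V" "A \<subseteq> V" "emeasure M V < ennreal (measure M A + e)"
    by (auto simp: INF_less_iff)
  have "measure M (V - A) = measure M V - measure M A"
    by (rule finite_measure_Diff) (use V A sets openin_borel_of in auto)
  also have "\<dots> < e" using V(3) by (simp add: emeasure_eq_measure ennreal_less_iff)
  finally show thesis using that V by blast
qed

text \<open>Take a compact \<open>K\<close> carrying all but \<open>e / 2\<close> of the total mass
  and an open \<open>V\<close> exceeding the complement of \<open>A\<close> by less than
  \<open>e / 2\<close>. Then \<open>K - V\<close> is compact, lies in \<open>A\<close> and misses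
  little of it.\<close>

lemma finite_regular_measure_inner:
  assumes "Hausdorff_space X" and M: "finite_regular_measure X M"
    and A: "A \<in> sets (borel_of X)" and e: "0 < e"
  obtains K where "compactin X K" "K \<subseteq> A" "measure M (A - K) < e"
proof -
  interpret finite_measure M using M by (simp add: finite_regular_measure_def)
  have sets: "sets M = sets (borel_of X)" using M by (simp add: finite_regular_measure_def)
  have top: "topspace X \<in> sets M" by (simp add: sets openin_borel_of)
  have K: "\<exists>K. compactin X K \<and> measure M (topspace X - K) < e / 2"
  \<comment> \<open>The split keeps \<open>measure M (topspace X) - e / 2\<close> nonnegative, since
    \<open>ennreal\<close> truncates negative numbers to 0. In the small case the empty set is
    compact enough.\<close>
  proof (cases "measure M (topspace X) < e / 2")
    case True
    then show ?thesis by (intro exI[of _ "{}"]) simp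
  next
    case False
    have "ennreal (measure M (topspace X) - e / 2) < emeasure M (topspace X)"
      using False e by (simp add: emeasure_eq_measure ennreal_less_iff)
    also have "\<dots> = (SUP K\<in>{K. compactin X K \<and> K \<subseteq> topspace X}. emeasure M K)"
      using M by (simp add: finite_regular_measure_def)
    finally obtain K where K: "compactin X K" "ennreal (measure M (topspace X) - e / 2) < emeasure M K"
      by (auto simp: less_SUP_iff)
    have "measure M (topspace X - K) = measure M (topspace X) - measure M K"
      by (rule finite_measure_Diff[OF top])
        (use compactin_borel_of[OF assms(1) K(1)] sets compactin_subset_topspace[OF K(1)] in auto)
    also have "\<dots> < e / 2" using K(2) False by (simp add: emeasure_eq_measure ennreal_less_iff)
    finally show ?thesis using K(1) by blast
  qed
  then obtain K where K: "compactin X K" "measure M (topspace X - K) < e / 2" by blast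
  have "topspace X - A \<in> sets (borel_of X)" using A by (metis sets.compl_sets space_borel_of)
  then obtain V where V: "openin X V" "topspace X - A \<subseteq> V" "measure M (V - (topspace X - A)) < e / 2"
    by (rule finite_regular_measure_outer[OF M _ half_gt_zero[OF e]])
  have Asub: "A \<subseteq> topspace X" using A sets.sets_into_space space_borel_of by metis
  have KM: "K \<in> sets M" using compactin_borel_of[OF assms(1) K(1)] by (simp add: sets)
  have VM: "V \<in> sets M" using openin_borel_of[OF V(1)] by (simp add: sets)
  have AM: "A \<in> sets M" using A by (simp add: sets)
  show thesis
  proof
    have "compactin X ((topspace X - V) \<inter> K)"
      using V(1) K(1) by (intro closed_Int_compactin) auto
    moreover have "(topspace X - V) \<inter> K = K - V" using compactin_subset_topspace[OF K(1)] by blast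
    ultimately show "compactin X (K - V)" by simp
    show "K - V \<subseteq> A" using V(2) compactin_subset_topspace[OF K(1)] by blast
    \<comment> \<open>A point of \<open>A\<close> outside \<open>K - V\<close> lies outside
      \<open>K\<close> or in the part of \<open>V\<close> inside \<open>A\<close>.\<close>
    have "measure M (A - (K - V)) \<le> measure M ((topspace X - K) \<union> (V - (topspace X - A)))"
      by (rule finite_measure_mono) (use Asub KM VM AM top in auto)
    also have "\<dots> \<le> measure M (topspace X - K) + measure M (V - (topspace X - A))"
      by (rule measure_Un_le) (use KM VM AM top in auto)
    also have "\<dots> < e" using K(2) V(3) by simp
    finally show "measure M (A - (K - V)) < e" .
  qed
qed

text \<open>The increment of \<mu> is that of \<open>M\<close> minus the nonnegative increment of
  \<open>N\<close>, which is dropped. This one-sided bound serves outer and inner approximation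
  alike.\<close>

lemma regular_signed_measure_bound:
  assumes "regular_signed_measure X \<mu>"
  obtains M where "finite_regular_measure X M"
    "\<And>A B. A \<in> sets (borel_of X) \<Longrightarrow> B \<in> sets (borel_of X) \<Longrightarrow> A \<subseteq> B \<Longrightarrow> \<mu> B - \<mu> A \<le> measure M (B - A)"
proof -
  obtain M N where M: "finite_regular_measure X M" and N: "finite_regular_measure X N"
    and \<mu>: "\<And>\<Delta>. \<Delta> \<in> sets (borel_of X) \<Longrightarrow> \<mu> \<Delta> = measure M \<Delta> - measure N \<Delta>"
    using assms by (auto simp: regular_signed_measure_def)
  show thesis
  proof
    fix A B assume AB: "A \<in> sets (borel_of X)" "B \<in> sets (borel_of X)" "A \<subseteq> B"
    have "measure M (B - A) = measure M B - measure M A" "measure N A \<le> measure N B"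
      using M N AB unfolding finite_regular_measure_def
      by (auto intro!: finite_measure.finite_measure_Diff finite_measure.finite_measure_mono)
    then show "\<mu> B - \<mu> A \<le> measure M (B - A)" using AB by (simp add: \<mu>)
  qed (rule M)
qed

lemma regular_signed_measure_outer:
  assumes "regular_signed_measure X \<mu>" "A \<in> sets (borel_of X)" "0 < e"
  obtains V where "openin X V" "A \<subseteq> V" "\<mu> V < \<mu> A + e"
proof -
  obtain M where M: "finite_regular_measure X M"
    "\<And>A B. A \<in> sets (borel_of X) \<Longrightarrow> B \<in> sets (borel_of X) \<Longrightarrow> A \<subseteq> B \<Longrightarrow> \<mu> B - \<mu> A \<le> measure M (B - A)"
    using regular_signed_measure_bound[OF assms(1)] by metis
  obtain V where V: "openin X V" "A \<subseteq> V" "measure M (V - A) < e"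
    by (rule finite_regular_measure_outer[OF M(1) assms(2,3)])
  with M(2)[OF assms(2) openin_borel_of[OF V(1)]] that show thesis by force
qed

lemma regular_signed_measure_inner:
  assumes "Hausdorff_space X" "regular_signed_measure X \<mu>" "A \<in> sets (borel_of X)" "0 < e"
  obtains K where "compactin X K" "K \<subseteq> A" "\<mu> A < \<mu> K + e"
proof -
  obtain M where M: "finite_regular_measure X M"
    "\<And>A B. A \<in> sets (borel_of X) \<Longrightarrow> B \<in> sets (borel_of X) \<Longrightarrow> A \<subseteq> B \<Longrightarrow> \<mu> B - \<mu> A \<le> measure M (B - A)"
    using regular_signed_measure_bound[OF assms(2)] by metis
  obtain K where K: "compactin X K" "K \<subseteq> A" "measure M (A - K) < e"
    by (rule finite_regular_measure_inner[OF assms(1) M(1) assms(3,4)])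
  with M(2)[OF compactin_borel_of[OF assms(1) K(1)] assms(3)] that show thesis by force
qed


section \<open>Regularity of positive spectral measures\<close>

lemma linear_regular_operator:
  assumes "regular_operator T" shows "linear T"
  using assms unfolding regular_operator_def positive_operator_def
  by (auto intro: linear_compose_sub)

text \<open>Countable additivity applied to the sequence \<open>A\<close>, \<open>B\<close>,
  \<open>{}\<close>, \<open>{}\<close>, ...; the tail vanishes because \<open>P {}\<close> is
  0.\<close>

lemma positive_spectral_measure_additive:
  assumes P: "positive_spectral_measure M P"
    and "A \<in> sets M" "B \<in> sets M" "A \<inter> B = {}"
  shows "P (A \<union> B) x = P A x + P B x"
proof -
  have "range (binaryset A B) \<subseteq> sets M" using assms by (auto simp: range_binaryset_eq)
  moreover have "disjoint_family (binaryset A B)"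
    using assms(4) by (auto simp: disjoint_family_on_def binaryset_def)
  ultimately have "(\<lambda>n. P (binaryset A B n) x) sums P (\<Union>n. binaryset A B n) x"
    using P by (simp add: positive_spectral_measure_def)
  moreover have "(\<lambda>n. P (binaryset A B n) x) sums (P A x + P B x)"
    using P by (intro binaryset_sums) (simp add: positive_spectral_measure_def)
  ultimately show ?thesis by (simp add: UN_binaryset_eq sums_unique2)
qed

text \<open>By additivity the difference is \<open>P (B - A)\<close>, itself a value of the spectral
  measure and so positive.\<close>

lemma positive_spectral_measure_mono:
  assumes P: "positive_spectral_measure M P"
    and A: "A \<in> sets M" and B: "B \<in> sets M" and "A \<subseteq> B"
  shows "positive_operator (\<lambda>x. P B x - P A x)"
proof -
  have "P B x = P A x + P (B - A) x" for x
    using positive_spectral_measure_additive[OF P A, of "B - A" x] A B \<open>A \<subseteq> B\<close>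
    by (simp add: Un_absorb1)
  then have "(\<lambda>x. P B x - P A x) = P (B - A)" by auto
  then show ?thesis using P A B by (simp add: positive_spectral_measure_def)
qed

theorem proposition5p3:
  fixes X :: "'a topology"
    and P :: "'a set \<Rightarrow> 'e::banach_lattice \<Rightarrow> 'e"
  assumes "locally_compact_space X" and "Hausdorff_space X"
    and "positive_spectral_measure (borel_of X) P"
    and "regular_spectral_measure X P"
  shows "\<forall>\<Delta>\<in>sets (borel_of X).
      is_infimum regular_operators {P V |V. openin X V \<and> \<Delta> \<subseteq> V} (P \<Delta>) \<and>
      is_supremum regular_operators {P K |K. compactin X K \<and> K \<subseteq> \<Delta>} (P \<Delta>)"
proof (intro ballI conjI)
  note P = assms(3)
  have positive: "positive_operator (P A)" if "A \<in> sets (borel_of X)" for A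
    using P that by (simp add: positive_spectral_measure_def)
  have lin: "linear (P A)" if "A \<in> sets (borel_of X)" for A
    using positive[OF that] by (simp add: positive_operator_def)
  have regular: "regular_operator (P A)" if "A \<in> sets (borel_of X)" for A
    using positive[OF that] by (rule positive_imp_regular_operator)
  have \<mu>: "regular_signed_measure X (\<lambda>\<Delta>. blinfun_apply f (P \<Delta> x))" for f :: "'e \<Rightarrow>\<^sub>L real" and x
    using assms(4) by (simp add: regular_spectral_measure_def)
  note op = openin_borel_of[of X] and co = compactin_borel_of[OF assms(2)]
  fix \<Delta> assume \<Delta>: "\<Delta> \<in> sets (borel_of X)"
  have inf: "positive_operator (\<lambda>x. P \<Delta> x - S x)"
    if S: "regular_operator S"
      and le: "\<And>V. openin X V \<Longrightarrow> \<Delta> \<subseteq> V \<Longrightarrow> positive_operator (\<lambda>x. P V x - S x)" for S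
    unfolding positive_operator_def
  proof (intro conjI allI impI)
    show "linear (\<lambda>x. P \<Delta> x - S x)"
      by (intro linear_compose_sub lin[OF \<Delta>] linear_regular_operator[OF S])
    fix x :: 'e assume x: "0 \<le> x"
    show "0 \<le> P \<Delta> x - S x"
    proof (rule nonneg_if_positive_functionals_nonneg)
      fix f :: "'e \<Rightarrow>\<^sub>L real" assume f: "\<And>x. 0 \<le> x \<Longrightarrow> 0 \<le> blinfun_apply f x"
      have "blinfun_apply f (S x) \<le> blinfun_apply f (P \<Delta> x) + e" if "0 < e" for e
      proof -
        \<comment> \<open>\<open>V\<close> may depend on \<open>f\<close>, \<open>x\<close> and
          \<open>e\<close>: the bound \<open>S\<close> lies below every \<open>P V\<close>, so one
          suitable set suffices for each test.\<close>
        obtain V where V: "openin X V" "\<Delta> \<subseteq> V" "blinfun_apply f (P V x) < blinfun_apply f (P \<Delta> x) + e"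
          using regular_signed_measure_outer[OF \<mu> \<Delta> \<open>0 < e\<close>] by metis
        have "0 \<le> blinfun_apply f (P V x - S x)"
          using le[OF V(1,2)] x by (intro f) (simp add: positive_operator_def)
        with V(3) show ?thesis by (simp add: blinfun.diff_right)
      qed
      then show "0 \<le> blinfun_apply f (P \<Delta> x - S x)"
        by (simp add: blinfun.diff_right field_le_epsilon)
    qed
  qed
  have sup: "positive_operator (\<lambda>x. S x - P \<Delta> x)"
    if S: "regular_operator S"
      and le: "\<And>K. compactin X K \<Longrightarrow> K \<subseteq> \<Delta> \<Longrightarrow> positive_operator (\<lambda>x. S x - P K x)" for S
    unfolding positive_operator_def
  proof (intro conjI allI impI)
    show "linear (\<lambda>x. S x - P \<Delta> x)"
      by (intro linear_compose_sub lin[OF \<Delta>] linear_regular_operator[OF S])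
    fix x :: 'e assume x: "0 \<le> x"
    show "0 \<le> S x - P \<Delta> x"
    proof (rule nonneg_if_positive_functionals_nonneg)
      fix f :: "'e \<Rightarrow>\<^sub>L real" assume f: "\<And>x. 0 \<le> x \<Longrightarrow> 0 \<le> blinfun_apply f x"
      have "blinfun_apply f (P \<Delta> x) \<le> blinfun_apply f (S x) + e" if "0 < e" for e
      proof -
        \<comment> \<open>Likewise \<open>K\<close> is chosen anew for each \<open>f\<close>,
          \<open>x\<close> and \<open>e\<close>, since \<open>S\<close> dominates every
          \<open>P K\<close>.\<close>
        obtain K where K: "compactin X K" "K \<subseteq> \<Delta>" "blinfun_apply f (P \<Delta> x) < blinfun_apply f (P K x) + e"
          using regular_signed_measure_inner[OF assms(2) \<mu> \<Delta> \<open>0 < e\<close>] by metis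
        have "0 \<le> blinfun_apply f (S x - P K x)"
          using le[OF K(1,2)] x by (intro f) (simp add: positive_operator_def)
        with K(3) show ?thesis by (simp add: blinfun.diff_right)
      qed
      then show "0 \<le> blinfun_apply f (S x - P \<Delta> x)"
        by (simp add: blinfun.diff_right field_le_epsilon)
    qed
  qed
  \<comment> \<open>Monotonicity of \<open>P\<close> makes \<open>P \<Delta>\<close> a lower bound;
    \<open>inf\<close> makes it the greatest among regular operators, so existence of the infimum is
    proved and not presupposed.\<close>
  show "is_infimum regular_operators {P V |V. openin X V \<and> \<Delta> \<subseteq> V} (P \<Delta>)"
    unfolding is_infimum_def greatest_def Lower_def regular_operators_def
    using inf regular[OF \<Delta>] regular[OF op] positive_spectral_measure_mono[OF P \<Delta> op]
    by (auto; blast)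
  show "is_supremum regular_operators {P K |K. compactin X K \<and> K \<subseteq> \<Delta>} (P \<Delta>)"
    unfolding is_supremum_def least_def Upper_def regular_operators_def
    using sup regular[OF \<Delta>] regular[OF co] positive_spectral_measure_mono[OF P co \<Delta>]
    by (auto; blast)
qed

end
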